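(* Let $(M,g_L)$ be a compact Lorentzian manifold with negative sectional curvature on timelike planes. If there exists a timelike unitary Killing vector field on $M$, then $M$ has odd dimension.
   Context: Lorentzian metrics have signature $(-,+,\dots,+)$. A timelike unitary vector field $E$ is one with $g_L(E,E)=-1$. A timelike plane is a tangent plane on which $g_L$ is nondegenerate and indefinite. The sectional curvature of a nondegenerate plane $\mathrm{span}(u,v)$ is $K(u,v)=\dfrac{g_L(R_{uv}v,u)}{g_L(u,u)g_L(v,v)-g_L(u,v)^2}$ with $R_{UV}W=\nabla_U\nabla_VW-\nabla_V\nabla_UW-\nabla_{[U,V]}W$. *)

theory Defs
  imports "HOL-Analysis.Analysis"
begin

section \<open>Smooth maps between normed spaces\<close>

text \<open>Used only on open sets \<open>S\<close>.\<close>

fun differentiable_times_on ::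
  "nat \<Rightarrow> 'b::real_normed_vector set \<Rightarrow> ('b \<Rightarrow> 'c::real_normed_vector) \<Rightarrow> bool" where
  "differentiable_times_on 0 S f \<longleftrightarrow> continuous_on S f"
| "differentiable_times_on (Suc k) S f \<longleftrightarrow>
     (\<forall>x\<in>S. f differentiable (at x)) \<and>
     (\<forall>v. differentiable_times_on k S (\<lambda>x. frechet_derivative f (at x) v))"

definition smooth_on ::
  "'b::real_normed_vector set \<Rightarrow> ('b \<Rightarrow> 'c::real_normed_vector) \<Rightarrow> bool" where
  "smooth_on S f \<longleftrightarrow> (\<forall>k. differentiable_times_on k S f)"

section \<open>Smooth manifolds\<close>

text \<open>A chart is a pair \<open>(U, \<phi>)\<close> of a domain and a coordinate map; the value of \<open>\<phi>\<close> outside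
  \<open>U\<close> is irrelevant.  A manifold modelled on \<^typ>\<open>real ^ 'n\<close> has dimension \<open>CARD('n)\<close>.\<close>

type_synonym ('a, 'n) chart = "'a set \<times> ('a \<Rightarrow> real ^ 'n)"

abbreviation chart_dom :: "('a, 'n) chart \<Rightarrow> 'a set" where
  "chart_dom c \<equiv> fst c"

abbreviation coord :: "('a, 'n) chart \<Rightarrow> 'a \<Rightarrow> real ^ 'n" where
  "coord c \<equiv> snd c"

abbreviation chart_inv :: "('a, 'n) chart \<Rightarrow> real ^ 'n \<Rightarrow> 'a" where
  "chart_inv c \<equiv> inv_into (chart_dom c) (coord c)"

definition is_chart :: "'a topology \<Rightarrow> ('a, 'n::finite) chart \<Rightarrow> bool" where
  "is_chart M c \<longleftrightarrow> openin M (chart_dom c) \<and> open (coord c ` chart_dom c) \<and>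
     homeomorphic_map (subtopology M (chart_dom c)) (top_of_set (coord c ` chart_dom c)) (coord c)"

definition transition :: "('a, 'n) chart \<Rightarrow> ('a, 'n) chart \<Rightarrow> real ^ 'n \<Rightarrow> real ^ 'n" where
  "transition c d = coord d \<circ> chart_inv c"

definition smooth_manifold :: "'a topology \<Rightarrow> ('a, 'n::finite) chart set \<Rightarrow> bool" where
  "smooth_manifold M A \<longleftrightarrow>
     topspace M \<noteq> {} \<and> Hausdorff_space M \<and> second_countable M \<and>
     (\<forall>c\<in>A. is_chart M c) \<and> (\<Union>c\<in>A. chart_dom c) = topspace M \<and>
     (\<forall>c\<in>A. \<forall>d\<in>A. smooth_on (coord c ` (chart_dom c \<inter> chart_dom d)) (transition c d))"

definition smooth_function :: "('a, 'n::finite) chart set \<Rightarrow> ('a \<Rightarrow> real) \<Rightarrow> bool" where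
  "smooth_function A f \<longleftrightarrow> (\<forall>c\<in>A. smooth_on (coord c ` chart_dom c) (f \<circ> chart_inv c))"

section \<open>Vector fields\<close>

text \<open>A tangent vector at \<open>p\<close> is a family of coordinate vectors, one for each chart around \<open>p\<close>,
  related by the derivatives of the transition maps.  Accordingly, for a vector field \<open>X\<close>, the
  vector \<open>X c p\<close> is the coordinate vector of the value of \<open>X\<close> at \<open>p\<close> in the chart \<open>c\<close>.  The
  convention \<open>X c p = 0\<close> for \<open>c \<notin> A\<close> or \<open>p \<notin> chart_dom c\<close> makes equality of vector fields the same
  as equality of functions.\<close>

type_synonym ('a, 'n) field = "('a, 'n) chart \<Rightarrow> 'a \<Rightarrow> real ^ 'n"

definition vector_field :: "('a, 'n::finite) chart set \<Rightarrow> ('a, 'n) field \<Rightarrow> bool" where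
  "vector_field A X \<longleftrightarrow>
     (\<forall>c p. \<not> (c \<in> A \<and> p \<in> chart_dom c) \<longrightarrow> X c p = 0) \<and>
     (\<forall>c\<in>A. smooth_on (coord c ` chart_dom c) (X c \<circ> chart_inv c)) \<and>
     (\<forall>c\<in>A. \<forall>d\<in>A. \<forall>p\<in>chart_dom c \<inter> chart_dom d.
        X d p = frechet_derivative (transition c d) (at (coord c p)) (X c p))"

definition field_add :: "('a, 'n::finite) field \<Rightarrow> ('a, 'n) field \<Rightarrow> ('a, 'n) field" where
  "field_add X Y = (\<lambda>c p. X c p + Y c p)"

definition field_diff :: "('a, 'n::finite) field \<Rightarrow> ('a, 'n) field \<Rightarrow> ('a, 'n) field" where
  "field_diff X Y = (\<lambda>c p. X c p - Y c p)"

definition field_scale :: "('a \<Rightarrow> real) \<Rightarrow> ('a, 'n::finite) field \<Rightarrow> ('a, 'n) field" where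
  "field_scale f X = (\<lambda>c p. f p *\<^sub>R X c p)"

text \<open>The derivative \<open>X f\<close> at \<open>p\<close>, computed in the chart \<open>c\<close>; only the values of \<open>f\<close> on
  \<open>chart_dom c\<close> near \<open>p\<close> matter.  For a real function \<open>f\<close> on the manifold the result does not depend
  on \<open>c\<close>.\<close>

definition deriv_along ::
  "('a, 'n::finite) chart \<Rightarrow> ('a, 'n) field \<Rightarrow> ('a \<Rightarrow> 'c::real_normed_vector) \<Rightarrow> 'a \<Rightarrow> 'c" where
  "deriv_along c X f p = frechet_derivative (f \<circ> chart_inv c) (at (coord c p)) (X c p)"

text \<open>In coordinates, \<open>[X, Y]\<^sup>k = X(Y\<^sup>k) - Y(X\<^sup>k)\<close>.\<close>

definition lie_bracket ::
  "('a, 'n::finite) chart set \<Rightarrow> ('a, 'n) field \<Rightarrow> ('a, 'n) field \<Rightarrow> ('a, 'n) field" where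
  "lie_bracket A X Y = (\<lambda>c p. if c \<in> A \<and> p \<in> chart_dom c
     then deriv_along c X (Y c) p - deriv_along c Y (X c) p else 0)"

section \<open>Lorentzian metrics\<close>

text \<open>\<open>g c p\<close> is the bilinear form of the metric at \<open>p\<close>, expressed in the chart \<open>c\<close>.\<close>

type_synonym ('a, 'n) metric_field =
  "('a, 'n) chart \<Rightarrow> 'a \<Rightarrow> real ^ 'n \<Rightarrow> real ^ 'n \<Rightarrow> real"

text \<open>Signature \<open>(-,+,\<dots>,+)\<close>: there is an orthonormal basis with exactly one timelike member.
  The vectors \<open>b i\<close> are linearly independent by orthonormality, hence a basis.\<close>

definition lorentzian_form :: "(real ^ 'n::finite \<Rightarrow> real ^ 'n \<Rightarrow> real) \<Rightarrow> bool" where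
  "lorentzian_form B \<longleftrightarrow> bilinear B \<and> (\<forall>u v. B u v = B v u) \<and>
     (\<exists>(b :: 'n \<Rightarrow> real ^ 'n) i0. \<forall>i j.
        B (b i) (b j) = (if i \<noteq> j then 0 else if i = i0 then -1 else 1))"

definition lorentzian_metric ::
  "('a, 'n::finite) chart set \<Rightarrow> ('a, 'n) metric_field \<Rightarrow> bool" where
  "lorentzian_metric A g \<longleftrightarrow>
     (\<forall>c\<in>A. \<forall>p\<in>chart_dom c. lorentzian_form (g c p)) \<and>
     (\<forall>c\<in>A. \<forall>u v. smooth_on (coord c ` chart_dom c) (\<lambda>x. g c (chart_inv c x) u v)) \<and>
     (\<forall>c\<in>A. \<forall>d\<in>A. \<forall>p\<in>chart_dom c \<inter> chart_dom d. \<forall>u v.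
        g d p (frechet_derivative (transition c d) (at (coord c p)) u)
              (frechet_derivative (transition c d) (at (coord c p)) v) = g c p u v)"

definition timelike_unitary ::
  "('a, 'n::finite) chart set \<Rightarrow> ('a, 'n) metric_field \<Rightarrow> ('a, 'n) field \<Rightarrow> bool" where
  "timelike_unitary A g E \<longleftrightarrow> (\<forall>c\<in>A. \<forall>p\<in>chart_dom c. g c p (E c p) (E c p) = -1)"

text \<open>The Lie derivative of \<open>g\<close> along \<open>E\<close> vanishes:
  \<open>E(g(X,Y)) = g([E,X],Y) + g(X,[E,Y])\<close> for all vector fields \<open>X\<close>, \<open>Y\<close>.\<close>

definition killing_field ::
  "('a, 'n::finite) chart set \<Rightarrow> ('a, 'n) metric_field \<Rightarrow> ('a, 'n) field \<Rightarrow> bool" where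
  "killing_field A g E \<longleftrightarrow> vector_field A E \<and>
     (\<forall>X Y. vector_field A X \<longrightarrow> vector_field A Y \<longrightarrow>
        (\<forall>c\<in>A. \<forall>p\<in>chart_dom c.
           deriv_along c E (\<lambda>q. g c q (X c q) (Y c q)) p =
             g c p (lie_bracket A E X c p) (Y c p) + g c p (X c p) (lie_bracket A E Y c p)))"

section \<open>Levi-Civita connection and curvature\<close>

type_synonym ('a, 'n) connection = "('a, 'n) field \<Rightarrow> ('a, 'n) field \<Rightarrow> ('a, 'n) field"

text \<open>\<open>D X Y\<close> stands for \<open>\<nabla>\<^sub>X Y\<close>; the values of \<open>D\<close> on arguments that are not vector fields are
  unconstrained.\<close>

definition affine_connection ::
  "('a, 'n::finite) chart set \<Rightarrow> ('a, 'n) connection \<Rightarrow> bool" where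
  "affine_connection A D \<longleftrightarrow>
     (\<forall>X Y. vector_field A X \<longrightarrow> vector_field A Y \<longrightarrow> vector_field A (D X Y)) \<and>
     (\<forall>X Y Z. vector_field A X \<longrightarrow> vector_field A Y \<longrightarrow> vector_field A Z \<longrightarrow>
        D (field_add X Y) Z = field_add (D X Z) (D Y Z) \<and>
        D X (field_add Y Z) = field_add (D X Y) (D X Z)) \<and>
     (\<forall>f X Y. smooth_function A f \<longrightarrow> vector_field A X \<longrightarrow> vector_field A Y \<longrightarrow>
        D (field_scale f X) Y = field_scale f (D X Y) \<and>
        D X (field_scale f Y) =
          field_add (\<lambda>c p. deriv_along c X f p *\<^sub>R Y c p) (field_scale f (D X Y)))"

definition torsion_free ::
  "('a, 'n::finite) chart set \<Rightarrow> ('a, 'n) connection \<Rightarrow> bool" where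
  "torsion_free A D \<longleftrightarrow>
     (\<forall>X Y. vector_field A X \<longrightarrow> vector_field A Y \<longrightarrow>
        field_diff (D X Y) (D Y X) = lie_bracket A X Y)"

definition metric_compatible ::
  "('a, 'n::finite) chart set \<Rightarrow> ('a, 'n) metric_field \<Rightarrow> ('a, 'n) connection \<Rightarrow> bool" where
  "metric_compatible A g D \<longleftrightarrow>
     (\<forall>X Y Z. vector_field A X \<longrightarrow> vector_field A Y \<longrightarrow> vector_field A Z \<longrightarrow>
        (\<forall>c\<in>A. \<forall>p\<in>chart_dom c.
           deriv_along c X (\<lambda>q. g c q (Y c q) (Z c q)) p =
             g c p (D X Y c p) (Z c p) + g c p (Y c p) (D X Z c p)))"

definition levi_civita ::
  "('a, 'n::finite) chart set \<Rightarrow> ('a, 'n) metric_field \<Rightarrow> ('a, 'n) connection \<Rightarrow> bool" where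
  "levi_civita A g D \<longleftrightarrow> affine_connection A D \<and> torsion_free A D \<and> metric_compatible A g D"

definition curvature ::
  "('a, 'n::finite) chart set \<Rightarrow> ('a, 'n) connection \<Rightarrow>
   ('a, 'n) field \<Rightarrow> ('a, 'n) field \<Rightarrow> ('a, 'n) field \<Rightarrow> ('a, 'n) field" where
  "curvature A D U V W =
     field_diff (field_diff (D U (D V W)) (D V (D U W))) (D (lie_bracket A U V) W)"

text \<open>The sectional curvature of the plane spanned at \<open>p\<close> by \<open>U\<close> and \<open>V\<close>, computed in the
  chart \<open>c\<close>; the value is independent of \<open>c\<close>.\<close>

definition sectional_curvature ::
  "('a, 'n::finite) chart set \<Rightarrow> ('a, 'n) metric_field \<Rightarrow> ('a, 'n) connection \<Rightarrow>
   ('a, 'n) chart \<Rightarrow> 'a \<Rightarrow> ('a, 'n) field \<Rightarrow> ('a, 'n) field \<Rightarrow> real" where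
  "sectional_curvature A g D c p U V =
     g c p (curvature A D U V V c p) (U c p) /
     (g c p (U c p) (U c p) * g c p (V c p) (V c p) - (g c p (U c p) (V c p))\<^sup>2)"

definition timelike_plane ::
  "(real ^ 'n::finite \<Rightarrow> real ^ 'n \<Rightarrow> real) \<Rightarrow> (real ^ 'n) set \<Rightarrow> bool" where
  "timelike_plane B P \<longleftrightarrow> subspace P \<and> dim P = 2 \<and>
     (\<forall>x\<in>P. (\<forall>y\<in>P. B x y = 0) \<longrightarrow> x = 0) \<and>
     (\<exists>x\<in>P. B x x < 0) \<and> (\<exists>x\<in>P. B x x > 0)"

text \<open>Every tangent vector extends to a global vector field and the curvature at \<open>p\<close> depends only
  on the values of the fields at \<open>p\<close>, so ranging over pairs of vector fields amounts to ranging
  over all bases of all timelike tangent planes at \<open>p\<close>.\<close>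

definition negative_timelike_curvature ::
  "('a, 'n::finite) chart set \<Rightarrow> ('a, 'n) metric_field \<Rightarrow> ('a, 'n) connection \<Rightarrow> bool" where
  "negative_timelike_curvature A g D \<longleftrightarrow>
     (\<forall>U V. vector_field A U \<longrightarrow> vector_field A V \<longrightarrow>
        (\<forall>c\<in>A. \<forall>p\<in>chart_dom c. timelike_plane (g c p) (span {U c p, V c p}) \<longrightarrow>
           sectional_curvature A g D c p U V < 0))"

end

theory Submission
  imports Defs "HOL-Computational_Algebra.Polynomial"
begin

text \<open>Let \<open>E\<close> be the unit timelike Killing field and \<open>p\<close> a point.  The Killing equation says that the
  endomorphism \<open>v \<mapsto> \<nabla>\<^sub>v E\<close> of the tangent space at \<open>p\<close> is skew for the metric
  (\<open>killing_skew\<close>), so \<open>\<omega>(v, w) = g(\<nabla>\<^sub>v E, w)\<close> is an alternating form.  Because \<open>g(E, E)\<close> is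
  constant, \<open>E\<close> lies in its radical and is geodesic.

  For a vector field \<open>X\<close> the curvature then collapses to
  \<open>g(R(X, E)E, X) = g(\<nabla>\<^sub>X E, \<nabla>\<^sub>X E)\<close> (\<open>curvature_killing\<close>).  If \<open>X\<close> is nonzero and orthogonal to
  \<open>E\<close> at \<open>p\<close>, then \<open>X\<close> and \<open>E\<close> span a timelike plane, whose sectional curvature is not zero;
  hence \<open>\<nabla>\<^sub>X E\<close> does not vanish at \<open>p\<close> (\<open>D_E_nonzero\<close>).  So the radical of \<open>\<omega>\<close> meets the orthogonal
  complement of \<open>E\<close> only in zero, that is, \<open>\<omega>\<close> is a nondegenerate alternating form on a space of
  dimension one less than that of the manifold.  Such a space has even dimension
  (\<open>odd_card_if_skew_radical_line\<close>).

  Connection and curvature act on global vector fields only, so the argument at \<open>p\<close> needs, for every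
  tangent vector \<open>v\<close> at \<open>p\<close>, a global field with value \<open>v\<close>
  (\<open>linear_vector_field_extension\<close>).  Choosing these fields linearly in \<open>v\<close> makes
  \<open>\<omega>\<close> bilinear, since a connection is linear in its first argument.  The fields are
  obtained by multiplying constant fields in a chart by a bump function; their smoothness rests on the calculus of iterated derivatives developed below.\<close>

section \<open>Calculus of smooth maps\<close>

lemma differentiable_times_on_cong:
  assumes "open S" "\<And>x. x \<in> S \<Longrightarrow> f x = g x" "differentiable_times_on k S f"
  shows "differentiable_times_on k S g"
  using assms(2,3)
proof (induction k arbitrary: f g)
  case 0
  then show ?case by (simp cong: continuous_on_cong)
next
  case (Suc k)
  have f: "f differentiable (at x)" if "x \<in> S" for x
    using Suc.prems that by simp
  have g: "g differentiable (at x)" if "x \<in> S" for x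
    using f[OF that] Suc.prems(1) assms(1) that
    by (meson differentiable_def has_derivative_transform_within_open)
  have "frechet_derivative f (at x) = frechet_derivative g (at x)" if "x \<in> S" for x
    using frechet_derivative_transform_within_open[OF f[OF that] assms(1) that] Suc.prems(1)
    by auto
  then have "differentiable_times_on k S (\<lambda>x. frechet_derivative g (at x) v)" for v
    using Suc.prems(2)
    by (intro Suc.IH[of "\<lambda>x. frechet_derivative f (at x) v" "\<lambda>x. frechet_derivative g (at x) v"])
      simp_all
  with g show ?case by simp
qed

lemma differentiable_times_on_local:
  assumes "\<And>x. x \<in> S \<Longrightarrow> \<exists>T. open T \<and> x \<in> T \<and> differentiable_times_on k T f"
  shows "differentiable_times_on k S f"
  using assms
proof (induction k arbitrary: f)
  case 0
  then have "\<forall>x\<in>S. isCont f x"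
    by (metis continuous_on_eq_continuous_at differentiable_times_on.simps(1))
  then show ?case
    by (simp add: continuous_at_imp_continuous_on)
next
  case (Suc k)
  have "f differentiable (at x)" if "x \<in> S" for x
    using Suc.prems[OF that] by auto
  moreover have "differentiable_times_on k S (\<lambda>x. frechet_derivative f (at x) v)" for v
  proof (rule Suc.IH)
    fix x assume "x \<in> S"
    from Suc.prems[OF this]
    show "\<exists>T. open T \<and> x \<in> T \<and> differentiable_times_on k T (\<lambda>x. frechet_derivative f (at x) v)"
      by auto
  qed
  ultimately show ?case by simp
qed

lemma differentiable_times_on_subset:
  "differentiable_times_on k S f \<Longrightarrow> T \<subseteq> S \<Longrightarrow> differentiable_times_on k T f"
proof (induction k arbitrary: f)
  case 0
  then show ?case by (auto intro: continuous_on_subset)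
qed auto

text \<open>The definition asks for continuity only of the last derivatives; that of the lower ones follows
  from differentiability.\<close>

lemma differentiable_times_on_SucD:
  "differentiable_times_on (Suc k) S f \<Longrightarrow> differentiable_times_on k S f"
proof (induction k arbitrary: f)
  case 0
  then show ?case
    by (auto intro!: continuous_at_imp_continuous_on differentiable_imp_continuous_within)
qed auto

lemma differentiable_times_on_const: "differentiable_times_on k S (\<lambda>x. a)"
proof (induction k arbitrary: a)
  case (Suc k)
  then show ?case by (simp add: frechet_derivative_const)
qed simp

lemma differentiable_times_on_bounded_linear:
  assumes "bounded_linear h"
  shows "differentiable_times_on k S h"
proof (cases k)
  case 0
  then show ?thesis by (simp add: assms linear_continuous_on)
next
  case (Suc m)
  have "(h has_derivative h) (at x)" for x
    by (rule bounded_linear_imp_has_derivative[OF assms])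
  then have "h differentiable (at x)" "frechet_derivative h (at x) = h" for x
    using frechet_derivative_at[of h h] by (auto simp: differentiable_def)
  then show ?thesis by (simp add: Suc differentiable_times_on_const)
qed

lemma differentiable_times_on_add:
  assumes "open S" "differentiable_times_on k S f" "differentiable_times_on k S g"
  shows "differentiable_times_on k S (\<lambda>x. f x + g x)"
  using assms(2,3)
proof (induction k arbitrary: f g)
  case 0
  then show ?case by (simp add: continuous_on_add)
next
  case (Suc k)
  have der: "((\<lambda>x. f x + g x) has_derivative
      (\<lambda>v. frechet_derivative f (at x) v + frechet_derivative g (at x) v)) (at x)"
    if "x \<in> S" for x
    using Suc.prems that
    by (intro has_derivative_add) (auto simp: frechet_derivative_works[symmetric])
  have "differentiable_times_on k S (\<lambda>x. frechet_derivative (\<lambda>x. f x + g x) (at x) v)" for v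
  proof (rule differentiable_times_on_cong[OF assms(1)])
    show "differentiable_times_on k S
        (\<lambda>x. frechet_derivative f (at x) v + frechet_derivative g (at x) v)"
      using Suc.prems by (intro Suc.IH) auto
  qed (simp add: frechet_derivative_at[OF der, symmetric])
  with der show ?case by (auto simp: differentiable_def)
qed

lemma differentiable_times_on_bilinear:
  assumes "open S" "bounded_bilinear h"
    "differentiable_times_on k S f" "differentiable_times_on k S g"
  shows "differentiable_times_on k S (\<lambda>x. h (f x) (g x))"
  using assms(3,4)
proof (induction k arbitrary: f g)
  case 0
  then show ?case by (simp add: bounded_bilinear.continuous_on[OF assms(2)])
next
  case (Suc k)
  have der: "((\<lambda>x. h (f x) (g x)) has_derivative
      (\<lambda>v. h (f x) (frechet_derivative g (at x) v) + h (frechet_derivative f (at x) v) (g x))) (at x)"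
    if "x \<in> S" for x
    using Suc.prems that
    by (intro bounded_bilinear.FDERIV[OF assms(2)]) (auto simp: frechet_derivative_works[symmetric])
  have "differentiable_times_on k S (\<lambda>x. frechet_derivative (\<lambda>x. h (f x) (g x)) (at x) v)" for v
  proof (rule differentiable_times_on_cong[OF assms(1)])
    show "differentiable_times_on k S
        (\<lambda>x. h (f x) (frechet_derivative g (at x) v) + h (frechet_derivative f (at x) v) (g x))"
      using Suc.prems differentiable_times_on_SucD[OF Suc.prems(1)]
        differentiable_times_on_SucD[OF Suc.prems(2)]
      by (intro differentiable_times_on_add assms Suc.IH) auto
  qed (simp add: frechet_derivative_at[OF der, symmetric])
  with der show ?case by (auto simp: differentiable_def)
qed

lemma differentiable_times_on_sum:
  assumes "open S" "finite I" "\<And>i. i \<in> I \<Longrightarrow> differentiable_times_on k S (f i)"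
  shows "differentiable_times_on k S (\<lambda>x. \<Sum>i\<in>I. f i x)"
  using assms(2,3)
proof (induction I rule: finite_induct)
  case empty
  then show ?case by (simp add: differentiable_times_on_const)
next
  case (insert i I)
  then show ?case by (simp add: differentiable_times_on_add[OF assms(1)])
qed

text \<open>By the chain rule the derivative of \<open>g \<circ> f\<close> in direction \<open>v\<close> is the derivative of \<open>g\<close> at \<open>f x\<close>,
  applied to a vector that itself varies with \<open>x\<close>, whereas smoothness of \<open>g\<close> speaks of fixed
  directions.  Expanding that vector in a basis reduces the step to sums, products and
  compositions with the finitely many partial derivatives of \<open>g\<close>; hence the inner map takes values
  in a Euclidean space.\<close>

lemma differentiable_times_on_compose:
  fixes f :: "'b::real_normed_vector \<Rightarrow> 'c::euclidean_space"
    and g :: "'c \<Rightarrow> 'd::real_normed_vector"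
  assumes "open S" "f ` S \<subseteq> T"
    "differentiable_times_on k S f" "differentiable_times_on k T g"
  shows "differentiable_times_on k S (\<lambda>x. g (f x))"
  using assms(3,4)
proof (induction k arbitrary: g)
  case 0
  then show ?case using assms(2) by (auto intro: continuous_on_compose2)
next
  case (Suc k)
  have der: "((\<lambda>x. g (f x)) has_derivative
      (\<lambda>v. frechet_derivative g (at (f x)) (frechet_derivative f (at x) v))) (at x)"
    if "x \<in> S" for x
  proof -
    have "(f has_derivative frechet_derivative f (at x)) (at x)"
      using Suc.prems(1) that by (auto simp: frechet_derivative_works[symmetric])
    moreover have "(g has_derivative frechet_derivative g (at (f x))) (at (f x))"
      using Suc.prems(2) that assms(2) by (auto simp: frechet_derivative_works[symmetric])
    ultimately show ?thesis by (rule has_derivative_compose)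
  qed
  have "differentiable_times_on k S (\<lambda>x. frechet_derivative (\<lambda>x. g (f x)) (at x) v)" for v
  proof (rule differentiable_times_on_cong[OF assms(1)])
    show "differentiable_times_on k S (\<lambda>x. \<Sum>b\<in>Basis.
        (frechet_derivative f (at x) v \<bullet> b) *\<^sub>R frechet_derivative g (at (f x)) b)"
    proof (intro differentiable_times_on_sum assms(1) finite_Basis
        differentiable_times_on_bilinear[OF _ bounded_bilinear_scaleR])
      fix b :: 'c
      show "differentiable_times_on k S (\<lambda>x. frechet_derivative f (at x) v \<bullet> b)"
        using Suc.prems(1)
        by (intro differentiable_times_on_bilinear[OF assms(1) bounded_bilinear_inner]
            differentiable_times_on_const) auto
      show "differentiable_times_on k S (\<lambda>x. frechet_derivative g (at (f x)) b)"
        using Suc.prems differentiable_times_on_SucD[OF Suc.prems(1)]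
        by (intro Suc.IH[of "\<lambda>y. frechet_derivative g (at y) b"]) simp_all
    qed
  next
    fix x assume x: "x \<in> S"
    let ?w = "frechet_derivative f (at x) v"
    have lin: "linear (frechet_derivative g (at (f x)))"
      using Suc.prems(2) x assms(2) by (intro linear_frechet_derivative) auto
    have "frechet_derivative g (at (f x)) ?w =
        frechet_derivative g (at (f x)) (\<Sum>b\<in>Basis. (?w \<bullet> b) *\<^sub>R b)"
      by (simp add: euclidean_representation)
    also have "\<dots> = (\<Sum>b\<in>Basis. (?w \<bullet> b) *\<^sub>R frechet_derivative g (at (f x)) b)"
      by (simp add: linear_sum[OF lin] linear_scale[OF lin])
    finally show "(\<Sum>b\<in>Basis. (?w \<bullet> b) *\<^sub>R frechet_derivative g (at (f x)) b) =
        frechet_derivative (\<lambda>x. g (f x)) (at x) v"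
      by (simp add: frechet_derivative_at[OF der[OF x], symmetric])
  qed
  with der show ?case by (auto simp: differentiable_def)
qed

lemma smooth_on_cong:
  "open S \<Longrightarrow> smooth_on S f \<Longrightarrow> (\<And>x. x \<in> S \<Longrightarrow> f x = g x) \<Longrightarrow> smooth_on S g"
  unfolding smooth_on_def by (intro allI differentiable_times_on_cong[of S f g]) auto

lemma smooth_on_local:
  "(\<And>x. x \<in> S \<Longrightarrow> \<exists>T. open T \<and> x \<in> T \<and> smooth_on T f) \<Longrightarrow> smooth_on S f"
  unfolding smooth_on_def by (intro allI differentiable_times_on_local) blast

lemma smooth_on_subset: "smooth_on S f \<Longrightarrow> T \<subseteq> S \<Longrightarrow> smooth_on T f"
  unfolding smooth_on_def by (intro allI differentiable_times_on_subset[of _ S f T]) auto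

lemma smooth_on_const: "smooth_on S (\<lambda>x. a)"
  by (simp add: smooth_on_def differentiable_times_on_const)

lemma smooth_on_bounded_linear: "bounded_linear h \<Longrightarrow> smooth_on S h"
  by (simp add: smooth_on_def differentiable_times_on_bounded_linear)

lemma smooth_on_add:
  "open S \<Longrightarrow> smooth_on S f \<Longrightarrow> smooth_on S g \<Longrightarrow> smooth_on S (\<lambda>x. f x + g x)"
  by (simp add: smooth_on_def differentiable_times_on_add)

lemma smooth_on_bilinear:
  "open S \<Longrightarrow> bounded_bilinear h \<Longrightarrow> smooth_on S f \<Longrightarrow> smooth_on S g \<Longrightarrow>
    smooth_on S (\<lambda>x. h (f x) (g x))"
  by (simp add: smooth_on_def differentiable_times_on_bilinear)

lemma smooth_on_compose:
  fixes f :: "'b::real_normed_vector \<Rightarrow> 'c::euclidean_space"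
  shows "open S \<Longrightarrow> f ` S \<subseteq> T \<Longrightarrow> smooth_on S f \<Longrightarrow> smooth_on T g \<Longrightarrow>
    smooth_on S (\<lambda>x. g (f x))"
  unfolding smooth_on_def by (intro allI differentiable_times_on_compose[of S f T _ g]) auto

lemma smooth_on_imp_differentiable:
  assumes "smooth_on S f" "x \<in> S"
  shows "f differentiable (at x)"
proof -
  have "differentiable_times_on (Suc 0) S f" using assms(1) by (simp only: smooth_on_def)
  with assms(2) show ?thesis by simp
qed

lemma smooth_on_frechet_derivative:
  assumes "smooth_on S f"
  shows "smooth_on S (\<lambda>x. frechet_derivative f (at x) v)"
proof -
  have "differentiable_times_on (Suc k) S f" for k using assms by (simp only: smooth_on_def)
  then show ?thesis by (simp add: smooth_on_def)
qed

section \<open>Bump functions\<close>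

text \<open>For \<open>p = 1\<close> this is the standard flat function.  Admitting all polynomials \<open>p\<close> makes the family
  closed under differentiation, so that its smoothness follows by induction.\<close>

definition flat_poly :: "real poly \<Rightarrow> real \<Rightarrow> real" where
  "flat_poly p t = (if t > 0 then poly p (1 / t) * exp (- 1 / t) else 0)"

text \<open>At infinity \<open>exp(-s)\<close> beats every polynomial in \<open>s = 1/t\<close>.\<close>

lemma flat_poly_limit: "(flat_poly p \<longlongrightarrow> 0) (at 0)"
proof -
  have "((\<lambda>s. poly p s * exp (- s)) \<longlongrightarrow> 0) at_top"
  proof -
    have "((\<lambda>s::real. s^n * exp (- s)) \<longlongrightarrow> 0) at_top" for n
      using tendsto_power_div_exp_0[of n] by (simp add: exp_minus field_simps)
    then have "((\<lambda>s. \<Sum>i\<le>degree p. coeff p i * (s ^ i * exp (- s))) \<longlongrightarrow> 0) at_top"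
      by (intro tendsto_null_sum tendsto_mult_right_zero)
    then show ?thesis by (simp add: poly_altdef sum_distrib_right mult.assoc)
  qed
  then have "((\<lambda>t. poly p (inverse t) * exp (- inverse t)) \<longlongrightarrow> 0) (at_right 0)"
    using filterlim_compose filterlim_inverse_at_top_right by blast
  then have "(flat_poly p \<longlongrightarrow> 0) (at_right 0)"
    by (rule Lim_transform_eventually)
      (auto simp: flat_poly_def eventually_at_right_field inverse_eq_divide intro!: exI[of _ 1])
  moreover have "(flat_poly p \<longlongrightarrow> 0) (at_left 0)"
    by (rule Lim_transform_eventually[OF tendsto_const])
      (auto simp: flat_poly_def eventually_at_left_field intro!: exI[of _ "-1"])
  ultimately show ?thesis by (simp add: filterlim_split_at)
qed

text \<open>For \<open>t > 0\<close> this is the product rule.  At \<open>0\<close> the difference quotient of the function for \<open>p\<close> is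
  the function for the polynomial \<open>s p(s)\<close>, which tends to \<open>0\<close>.\<close>

lemma flat_poly_has_derivative:
  "(flat_poly p has_real_derivative flat_poly (monom 1 2 * (p - pderiv p)) t) (at t)"
proof -
  consider "t > 0" | "t < 0" | "t = 0" by linarith
  then show ?thesis
  proof cases
    case 1
    have "((\<lambda>t. poly p (1 / t) * exp (- 1 / t)) has_real_derivative
        flat_poly (monom 1 2 * (p - pderiv p)) t) (at t)"
    proof -
      have inv: "((\<lambda>t. - 1 / t) has_real_derivative 1 / t\<^sup>2) (at t)"
        using 1 by (auto intro!: derivative_eq_intros simp: power2_eq_square)
      have p: "((\<lambda>t. poly p (1 / t)) has_real_derivative poly (pderiv p) (1 / t) * - (1 / t\<^sup>2)) (at t)"
        using DERIV_minus[OF inv] by (intro DERIV_chain2[OF poly_DERIV]) simp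
      have e: "((\<lambda>t. exp (- 1 / t)) has_real_derivative exp (- 1 / t) * (1 / t\<^sup>2)) (at t)"
        by (rule DERIV_chain2[OF DERIV_exp inv])
      have "poly p (1 / t) * (exp (- 1 / t) * (1 / t\<^sup>2)) +
          (poly (pderiv p) (1 / t) * - (1 / t\<^sup>2)) * exp (- 1 / t) =
          flat_poly (monom 1 2 * (p - pderiv p)) t"
        using 1 by (simp add: flat_poly_def poly_monom power_one_over left_diff_distrib right_diff_distrib)
      with DERIV_mult'[OF p e] show ?thesis by simp
    qed
    then show ?thesis
      by (rule DERIV_cong_ev[THEN iffD1, rotated -1])
        (use 1 in \<open>auto simp: flat_poly_def eventually_nhds intro!: exI[of _ "{0<..}"]\<close>)
  next
    case 2
    have "((\<lambda>t. 0) has_real_derivative flat_poly (monom 1 2 * (p - pderiv p)) t) (at t)"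
      using 2 by (simp add: flat_poly_def)
    then show ?thesis
      by (rule DERIV_cong_ev[THEN iffD1, rotated -1])
        (use 2 in \<open>auto simp: flat_poly_def eventually_nhds intro!: exI[of _ "{..<0}"]\<close>)
  next
    case 3
    have "((\<lambda>h. (flat_poly p (0 + h) - flat_poly p 0) / h) \<longlongrightarrow> 0) (at 0)"
      by (rule Lim_transform_eventually[OF flat_poly_limit[of "pCons 0 p"]])
        (auto simp: flat_poly_def eventually_at_filter)
    then show ?thesis
      using 3 by (simp add: DERIV_def flat_poly_def)
  qed
qed

lemma smooth_on_flat_poly: "smooth_on S (flat_poly p)"
proof -
  have der: "(flat_poly p has_derivative (\<lambda>v. v * flat_poly (monom 1 2 * (p - pderiv p)) t)) (at t)"
    for p t
    using flat_poly_has_derivative[of p t] by (simp add: has_field_derivative_def mult_commute_abs)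
  have "differentiable_times_on k UNIV (flat_poly p)" for k
  proof (induction k arbitrary: p)
    case 0
    then show ?case
      by (simp add: continuous_at_imp_continuous_on DERIV_isCont[OF flat_poly_has_derivative])
  next
    case (Suc k)
    have "frechet_derivative (flat_poly p) (at t) v = v * flat_poly (monom 1 2 * (p - pderiv p)) t"
      for t v
      by (simp add: frechet_derivative_at[OF der, symmetric])
    moreover have "flat_poly p differentiable (at t)" for t
      unfolding differentiable_def using der by blast
    ultimately show ?case
      using Suc.IH by (auto intro!: differentiable_times_on_const
          differentiable_times_on_bilinear[OF open_UNIV bounded_bilinear_mult])
  qed
  then show ?thesis
    unfolding smooth_on_def by (auto intro: differentiable_times_on_subset[OF _ subset_UNIV, of _ _ S])
qed

text \<open>The function for \<open>p = 1\<close>, evaluated at \<open>r\<^sup>2 - |x - x0|\<^sup>2\<close> and normalised at the centre.\<close>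

lemma smooth_bump_exists:
  fixes x0 :: "'b::euclidean_space"
  assumes "r > 0"
  obtains \<beta> :: "'b \<Rightarrow> real" where "smooth_on UNIV \<beta>" "\<beta> x0 = 1" "\<And>x. x \<notin> cball x0 r \<Longrightarrow> \<beta> x = 0"
proof
  let ?\<psi> = "\<lambda>t. flat_poly 1 t / flat_poly 1 (r\<^sup>2)"
  define \<beta> where "\<beta> x = ?\<psi> (r\<^sup>2 - (x - x0) \<bullet> (x - x0))" for x
  \<comment> \<open>Differences are written as sums with scaled summands, the operations known to be smooth.\<close>
  have shift: "smooth_on UNIV (\<lambda>x. x + (- x0))"
    by (intro smooth_on_add smooth_on_const smooth_on_bounded_linear bounded_linear_ident) simp
  have "smooth_on UNIV (\<lambda>x. r\<^sup>2 + (- 1) *\<^sub>R ((x + (- x0)) \<bullet> (x + (- x0))))"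
    by (intro smooth_on_add smooth_on_bilinear[OF _ bounded_bilinear_scaleR] smooth_on_const
        smooth_on_bilinear[OF _ bounded_bilinear_inner] shift open_UNIV)
  then have "smooth_on UNIV (\<lambda>x. flat_poly 1 (r\<^sup>2 + (- 1) *\<^sub>R ((x + (- x0)) \<bullet> (x + (- x0)))))"
    by (rule smooth_on_compose[OF open_UNIV subset_UNIV _ smooth_on_flat_poly])
  then have "smooth_on UNIV (\<lambda>x. flat_poly 1 (r\<^sup>2 + (- 1) *\<^sub>R ((x + (- x0)) \<bullet> (x + (- x0)))) *
      inverse (flat_poly 1 (r\<^sup>2)))"
    by (intro smooth_on_bilinear[OF _ bounded_bilinear_mult] smooth_on_const open_UNIV)
  then show "smooth_on UNIV \<beta>"
    unfolding \<beta>_def by (simp add: divide_inverse)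
  show "\<beta> x0 = 1"
    using assms by (simp add: \<beta>_def flat_poly_def)
  show "\<beta> x = 0" if "x \<notin> cball x0 r" for x
  proof -
    have "r < norm (x - x0)" using that by (simp add: dist_norm norm_minus_commute)
    then have "r\<^sup>2 < (x - x0) \<bullet> (x - x0)"
      using assms by (metis dot_square_norm power_strict_mono zero_less_numeral less_imp_le)
    then show ?thesis by (simp add: \<beta>_def flat_poly_def)
  qed
qed

section \<open>Lorentzian linear algebra\<close>

text \<open>The orthonormal family is a basis: the coordinates of a vector can be read off from its products
  with the family, so the map that forms linear combinations of it is injective.  In these
  coordinates the form is the Minkowski form.\<close>

lemma lorentzian_form_coordinates:
  fixes B :: "real ^ 'n::finite \<Rightarrow> real ^ 'n \<Rightarrow> real"
  assumes "lorentzian_form B"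
  obtains T :: "real ^ 'n \<Rightarrow> real ^ 'n" and i where
    "linear T" "surj T" "\<And>x y. B (T x) (T y) = x \<bullet> y - 2 * x $ i * y $ i"
proof -
  from assms obtain b :: "'n \<Rightarrow> real ^ 'n" and i where bil: "bilinear B"
    and b: "\<And>j k. B (b j) (b k) = (if j \<noteq> k then 0 else if j = i then - 1 else 1)"
    unfolding lorentzian_form_def by blast
  define T where "T x = (\<Sum>j\<in>UNIV. x $ j *\<^sub>R b j)" for x :: "real ^ 'n"
  have lin: "linear T"
    unfolding T_def by (intro linearI)
      (simp_all add: scaleR_left_distrib sum.distrib scaleR_sum_right)
  have B: "B (T x) (T y) = x \<bullet> y - 2 * x $ i * y $ i" for x y
  proof -
    have "B (T x) (T y) = (\<Sum>(j, k)\<in>UNIV \<times> UNIV. B (x $ j *\<^sub>R b j) (y $ k *\<^sub>R b k))"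
      unfolding T_def by (rule bilinear_sum[OF bil])
    also have "\<dots> = (\<Sum>j\<in>UNIV. \<Sum>k\<in>UNIV. if k = j then x $ j * y $ j * (if j = i then - 1 else 1) else 0)"
      unfolding sum.cartesian_product
      by (rule sum.cong) (auto simp: bilinear_lmul[OF bil] bilinear_rmul[OF bil] b)
    also have "\<dots> = (\<Sum>j\<in>UNIV. x $ j * y $ j - (if j = i then 2 * x $ j * y $ j else 0))"
      by (rule sum.cong) auto
    also have "\<dots> = x \<bullet> y - 2 * x $ i * y $ i"
      by (simp add: sum_subtractf inner_vec_def)
    finally show ?thesis .
  qed
  \<comment> \<open>Flipping the sign of the timelike coordinate turns the form into the Euclidean product.\<close>
  have "x = 0" if "T x = 0" for x
  proof -
    have "B (T x) (T (x - (2 * x $ i) *\<^sub>R axis i 1)) = x \<bullet> x"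
      unfolding B by (simp add: inner_diff_right inner_axis)
    with that have "x \<bullet> x = 0" by (simp add: bilinear_lzero[OF bil])
    then show ?thesis by simp
  qed
  then have "inj T" by (simp add: linear_injective_0[OF lin])
  with lin have "surj T" using linear_injective_imp_surjective by blast
  with lin show thesis using B by (rule that)
qed

lemma lorentzian_form_nondegenerate:
  fixes B :: "real ^ 'n::finite \<Rightarrow> real ^ 'n \<Rightarrow> real"
  assumes "lorentzian_form B" "\<And>w. B v w = 0"
  shows "v = 0"
proof -
  obtain T :: "real ^ 'n \<Rightarrow> real ^ 'n" and i where T: "linear T" "surj T" and B: "\<And>x y. B (T x) (T y) = x \<bullet> y - 2 * x $ i * y $ i"
    using lorentzian_form_coordinates[OF assms(1)] by blast
  obtain x where x: "v = T x" using T(2) by auto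
  have "B v (T (x - (2 * x $ i) *\<^sub>R axis i 1)) = x \<bullet> x"
    unfolding x B by (simp add: inner_diff_right inner_axis)
  with assms(2) show ?thesis by (simp add: x linear_0[OF T(1)])
qed

text \<open>Write \<open>x\<close>, \<open>y\<close> for the coordinates of \<open>v\<close>, \<open>e\<close> and \<open>x'\<close>, \<open>y'\<close> for their spacelike parts.
  Orthogonality and normalisation give \<open>x' \<bullet> y' = x\<^sub>i y\<^sub>i\<close> and \<open>y' \<bullet> y' = y\<^sub>i\<^sup>2 - 1\<close>, so the
  Cauchy-Schwarz inequality for \<open>x'\<close> and \<open>y'\<close> forces \<open>x' \<bullet> x' > x\<^sub>i\<^sup>2\<close> unless \<open>x = 0\<close>.\<close>

lemma lorentzian_form_orthogonal_timelike:
  fixes B :: "real ^ 'n::finite \<Rightarrow> real ^ 'n \<Rightarrow> real"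
  assumes "lorentzian_form B" "B e e = - 1" "B v e = 0" "v \<noteq> 0"
  shows "B v v > 0"
proof -
  obtain T :: "real ^ 'n \<Rightarrow> real ^ 'n" and i where T: "linear T" "surj T" and B: "\<And>x y. B (T x) (T y) = x \<bullet> y - 2 * x $ i * y $ i"
    using lorentzian_form_coordinates[OF assms(1)] by blast
  obtain x y where x: "v = T x" and y: "e = T y" using T(2) by (metis surjD)
  define x' where "x' = x - (x $ i) *\<^sub>R axis i 1"
  define y' where "y' = y - (y $ i) *\<^sub>R axis i 1"
  have inner': "x' \<bullet> y' = x \<bullet> y - x $ i * y $ i" "x' \<bullet> x' = x \<bullet> x - x $ i * x $ i"
    "y' \<bullet> y' = y \<bullet> y - y $ i * y $ i"
    by (simp_all add: x'_def y'_def inner_diff_left inner_diff_right inner_axis inner_axis')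
  have "(x' \<bullet> y')\<^sup>2 \<le> (x' \<bullet> x') * (y' \<bullet> y')"
    by (rule Cauchy_Schwarz_ineq)
  moreover have "x' \<bullet> y' = x $ i * y $ i" "y' \<bullet> y' = (y $ i)\<^sup>2 - 1"
    using assms(2,3) by (simp_all add: x y B inner' power2_eq_square)
  ultimately have cs: "(x $ i)\<^sup>2 * (y $ i)\<^sup>2 \<le> (x' \<bullet> x') * ((y $ i)\<^sup>2 - 1)"
    and y1: "0 \<le> (y $ i)\<^sup>2 - 1"
    by (simp_all add: power_mult_distrib) (metis inner_ge_zero diff_ge_0_iff_ge)
  have "x' \<bullet> x' > (x $ i)\<^sup>2"
  proof (rule ccontr)
    assume "\<not> x' \<bullet> x' > (x $ i)\<^sup>2"
    then have le: "x' \<bullet> x' \<le> (x $ i)\<^sup>2" by simp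
    have "(x $ i)\<^sup>2 * (y $ i)\<^sup>2 \<le> (x $ i)\<^sup>2 * (y $ i)\<^sup>2 - (x $ i)\<^sup>2"
      using order_trans[OF cs mult_right_mono[OF le y1]]
      by (simp only: right_diff_distrib mult_1_right)
    then have "x $ i = 0" by simp
    with le inner_ge_zero[of x'] have "x' \<bullet> x' = 0" by simp
    then have "x' = 0" by simp
    with \<open>x $ i = 0\<close> have "x = 0" by (simp add: x'_def)
    with assms(4) show False by (simp add: x linear_0[OF T(1)])
  qed
  then show ?thesis by (simp add: x B inner' power2_eq_square)
qed

lemma timelike_plane_span:
  assumes "lorentzian_form B" "B e e = - 1" "B v e = 0" "v \<noteq> 0"
  shows "timelike_plane B (span {v, e})"
proof -
  have bil: "bilinear B" and sym: "\<And>u w. B u w = B w u"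
    using assms(1) by (auto simp: lorentzian_form_def)
  have vv: "B v v > 0" by (rule lorentzian_form_orthogonal_timelike[OF assms])
  note bsimps = bilinear_ladd[OF bil] bilinear_radd[OF bil] bilinear_lmul[OF bil]
    bilinear_rmul[OF bil] assms(2,3) sym[of e v]
  have comb: "a = 0 \<and> b = 0" if "\<And>y. y \<in> {v, e} \<Longrightarrow> B (a *\<^sub>R v + b *\<^sub>R e) y = 0" for a b
    using that[of v] that[of e] vv by (simp add: bsimps)
  have "v \<noteq> k *\<^sub>R e" for k
    using assms(3) vv by (auto simp: bsimps)
  then have "independent {v, e}" "v \<noteq> e"
    using assms(2) by (auto simp: independent_insert span_singleton bilinear_lzero[OF bil])
       (metis scaleR_one)
  then have "dim (span {v, e}) = 2"
    using dim_eq_card_independent[of "{v, e}"] by simp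
  moreover have "x = 0" if mem: "x \<in> span {v, e}" and orth: "\<forall>y\<in>span {v, e}. B x y = 0" for x
  proof -
    obtain a where "x - a *\<^sub>R v \<in> span {e}"
      using mem span_breakdown_eq by metis
    then obtain b where "x - a *\<^sub>R v = b *\<^sub>R e"
      by (auto simp: span_singleton)
    then have x: "x = a *\<^sub>R v + b *\<^sub>R e"
      by (simp add: algebra_simps)
    have "B x v = 0" "B x e = 0"
      using orth by (simp_all add: span_base)
    then have "a = 0 \<and> b = 0"
      by (intro comb) (auto simp: x)
    with x show ?thesis by simp
  qed
  ultimately show ?thesis
    unfolding timelike_plane_def using vv assms(2)
    by (intro conjI subspace_span bexI[of _ v] bexI[of _ e]) (auto simp: span_base)
qed

text \<open>Here \<open>\<omega>\<close> restricts to a nondegenerate alternating form on the kernel of \<open>\<phi>\<close>, which has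
  codimension one.  Instead of restricting, border the matrix of \<open>\<omega>\<close> by \<open>\<phi>\<close> and \<open>-\<phi>\<close>: the result is
  a skew matrix with one more row and column.  If its size were odd, its determinant would
  vanish, and a kernel vector would consist of a vector \<open>x\<close> with \<open>\<phi> x = 0\<close> and a scalar \<open>s\<close> with
  \<open>\<omega> y x + s \<phi> y = 0\<close> for all \<open>y\<close>.  Putting \<open>y = e\<close> gives \<open>s = 0\<close>, and then \<open>x = 0\<close>.\<close>

lemma odd_card_if_skew_radical_line:
  fixes \<omega> :: "real ^ 'n::finite \<Rightarrow> real ^ 'n \<Rightarrow> real" and \<phi> :: "real ^ 'n \<Rightarrow> real"
  assumes \<omega>: "bilinear \<omega>" "\<And>x y. \<omega> x y = - \<omega> y x"
    and \<phi>: "linear \<phi>"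
    and e: "\<And>y. \<omega> e y = 0" "\<phi> e \<noteq> 0"
    and nondeg: "\<And>x. \<phi> x = 0 \<Longrightarrow> (\<And>y. \<omega> y x = 0) \<Longrightarrow> x = 0"
  shows "odd CARD('n)"
proof
  assume even: "even CARD('n)"
  define b where "b i = (axis i 1 :: real ^ 'n)" for i
  define N :: "real ^ 'n option ^ 'n option" where
    "N = (\<chi> r s. case (r, s) of (Some i, Some j) \<Rightarrow> \<omega> (b i) (b j) | (Some i, None) \<Rightarrow> \<phi> (b i)
       | (None, Some j) \<Rightarrow> - \<phi> (b j) | (None, None) \<Rightarrow> 0)"
  have "transpose N = (\<chi> r. (- 1) *s N $ r)"
  proof -
    have swap: "N $ s $ r = - (N $ r $ s)" for r s
      by (cases r; cases s) (simp_all add: N_def \<omega>(2)[symmetric])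
    show ?thesis
      unfolding vec_eq_iff transpose_def by (intro allI) (simp, rule swap)
  qed
  then have "det N = det (\<chi> r. (- 1) *s N $ r)"
    using det_transpose[of N] by simp
  also have "\<dots> = - det N"
    by (subst det_rows_mul) (simp add: even)
  finally have "det N = 0" by simp
  then obtain z where z: "z \<noteq> 0" "N *v z = 0"
    by (metis invertible_det_nz invertible_left_inverse matrix_left_invertible_ker)
  define x where "x = (\<Sum>j\<in>UNIV. z $ Some j *\<^sub>R b j)"
  have split: "(N *v z) $ r = (\<Sum>j\<in>UNIV. N $ r $ Some j * z $ Some j) + N $ r $ None * z $ None" for r
    by (simp add: matrix_vector_mult_def UNIV_option_conv sum.reindex)
  have "\<phi> x = 0"
    using split[of None] z(2)
    by (simp add: N_def x_def linear_sum[OF \<phi>] linear_scale[OF \<phi>] sum_negf mult.commute)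
  have row: "\<omega> (b i) x + \<phi> (b i) * z $ None = 0" for i
    using split[of "Some i"] z(2)
    by (simp add: N_def x_def linear_sum linear_scale mult.commute
        \<omega>(1)[unfolded bilinear_def])
  have *: "\<omega> y x + \<phi> y * z $ None = 0" for y
  proof -
    have lin: "linear (\<lambda>y. \<omega> y x + \<phi> y * z $ None)"
      using \<omega>(1) \<phi> by (intro linear_compose_add)
        (auto simp: bilinear_def linear_iff algebra_simps)
    have "(\<lambda>y. \<omega> y x + \<phi> y * z $ None) (\<Sum>i\<in>UNIV. y $ i *\<^sub>R b i) = 0"
      unfolding linear_sum[OF lin] linear_scale[OF lin] using row by simp
    then show ?thesis
      using basis_expansion[of y] by (simp add: b_def scalar_mult_eq_scaleR)
  qed
  from *[of e] e have "z $ None = 0" by simp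
  with * have "x = 0" by (intro nondeg \<open>\<phi> x = 0\<close>) simp
  then have "z $ Some j = 0" for j
  proof -
    have "x $ j = z $ Some j"
      by (simp add: x_def b_def axis_def if_distrib cong: if_cong)
    with \<open>x = 0\<close> show ?thesis by simp
  qed
  with \<open>z $ None = 0\<close> have "z $ r = 0" for r by (cases r) auto
  then have "z = 0" by (simp add: vec_eq_iff)
  with z(1) show False ..
qed

section \<open>Charts\<close>

lemma coord_inv_into:
  assumes "is_chart M c" "q \<in> chart_dom c"
  shows "chart_inv c (coord c q) = q"
proof -
  have "chart_dom c \<subseteq> topspace M"
    using assms(1) openin_subset by (auto simp: is_chart_def)
  then have "inj_on (coord c) (chart_dom c)"
    using homeomorphic_imp_injective_map[of "subtopology M (chart_dom c)" _ "coord c"] assms(1)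
    by (auto simp: is_chart_def Int_absorb1)
  with assms(2) show ?thesis by simp
qed

lemma open_coord_image:
  assumes "is_chart M c" "openin M U" "U \<subseteq> chart_dom c"
  shows "open (coord c ` U)"
proof -
  have "openin (subtopology M (chart_dom c)) U"
    using assms(2,3) by (simp add: openin_subtopology) (metis Int_absorb2)
  then have "openin (top_of_set (coord c ` chart_dom c)) (coord c ` U)"
    using assms(1) homeomorphic_map_openness_eq unfolding is_chart_def by metis
  then show ?thesis
    using assms(1) openin_open_trans by (auto simp: is_chart_def)
qed

lemma compactin_coord_preimage:
  assumes "is_chart M c" "compact K" "K \<subseteq> coord c ` chart_dom c"
  shows "compactin M {q \<in> chart_dom c. coord c q \<in> K}"
proof -
  let ?U = "{q \<in> chart_dom c. coord c q \<in> K}"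
  have "coord c ` ?U = K" using assms(3) by auto
  then have "compactin (top_of_set (coord c ` chart_dom c)) (coord c ` ?U)"
    using assms(2,3) by (simp add: compactin_subtopology)
  moreover have "?U \<subseteq> topspace (subtopology M (chart_dom c))"
    using assms(1) openin_subset by (fastforce simp: is_chart_def)
  ultimately have "compactin (subtopology M (chart_dom c)) ?U"
    using assms(1) homeomorphic_map_compactness unfolding is_chart_def by blast
  then show ?thesis by (simp add: compactin_subtopology)
qed

text \<open>Constancy is required only on the chart domain, as the expressions to be differentiated are
  known there only.\<close>

lemma deriv_along_const:
  assumes "is_chart M c" "p \<in> chart_dom c" "\<And>q. q \<in> chart_dom c \<Longrightarrow> f q = k"
  shows "deriv_along c X f p = 0"
proof -
  have "(f \<circ> chart_inv c has_derivative (\<lambda>_. 0)) (at (coord c p))"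
  proof (rule has_derivative_transform_within_open)
    show "((\<lambda>_. k) has_derivative (\<lambda>_. 0)) (at (coord c p))" by simp
    show "open (coord c ` chart_dom c)" using assms(1) by (simp add: is_chart_def)
    show "coord c p \<in> coord c ` chart_dom c" using assms(2) by simp
    show "k = (f \<circ> chart_inv c) x" if "x \<in> coord c ` chart_dom c" for x
      using that assms(3) coord_inv_into[OF assms(1)] by auto
  qed
  then show ?thesis
    by (simp add: deriv_along_def frechet_derivative_at[symmetric])
qed

section \<open>Extending tangent vectors to global vector fields\<close>

context
  fixes M :: "'a topology" and A :: "('a, 'n::finite) chart set"
  assumes manifold: "smooth_manifold M A"
begin

lemma atlas_chart: "c \<in> A \<Longrightarrow> is_chart M c"
  using manifold by (simp add: smooth_manifold_def)

lemma open_overlap: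
  assumes "c \<in> A" "d \<in> A" "U \<subseteq> chart_dom c" "openin M U"
  shows "open (coord c ` U)"
  using open_coord_image atlas_chart assms by blast

lemma openin_chart_dom: "c \<in> A \<Longrightarrow> openin M (chart_dom c)"
  using atlas_chart is_chart_def by blast

lemma transition_coord:
  "c \<in> A \<Longrightarrow> q \<in> chart_dom c \<Longrightarrow> transition c d (coord c q) = coord d q"
  using coord_inv_into[OF atlas_chart] by (simp add: transition_def)

lemma transition_has_derivative:
  assumes "c \<in> A" "d \<in> A" "q \<in> chart_dom c" "q \<in> chart_dom d"
  shows "(transition c d has_derivative frechet_derivative (transition c d) (at (coord c q)))
    (at (coord c q))"
proof -
  have "smooth_on (coord c ` (chart_dom c \<inter> chart_dom d)) (transition c d)"
    using manifold assms(1,2) by (simp add: smooth_manifold_def)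
  then have "transition c d differentiable (at (coord c q))"
    by (rule smooth_on_imp_differentiable) (use assms(3,4) in auto)
  then show ?thesis by (simp add: frechet_derivative_works)
qed

lemma transition_derivative_linear:
  assumes "c \<in> A" "d \<in> A" "q \<in> chart_dom c" "q \<in> chart_dom d"
  shows "linear (frechet_derivative (transition c d) (at (coord c q)))"
  using transition_has_derivative[OF assms] has_derivative_linear by blast

lemma transition_derivative_cocycle:
  assumes "c \<in> A" "d \<in> A" "e \<in> A" "q \<in> chart_dom c" "q \<in> chart_dom d" "q \<in> chart_dom e"
  shows "frechet_derivative (transition c e) (at (coord c q)) v =
    frechet_derivative (transition d e) (at (coord d q))
      (frechet_derivative (transition c d) (at (coord c q)) v)"
proof -
  let ?U = "chart_dom c \<inter> chart_dom d \<inter> chart_dom e"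
  have comp: "((\<lambda>x. transition d e (transition c d x)) has_derivative
      (\<lambda>v. frechet_derivative (transition d e) (at (coord d q))
        (frechet_derivative (transition c d) (at (coord c q)) v))) (at (coord c q))"
    using transition_has_derivative[of d e q] transition_coord[of c q d] assms
    by (intro has_derivative_compose[OF transition_has_derivative]) simp_all
  have "(transition c e has_derivative
      (\<lambda>v. frechet_derivative (transition d e) (at (coord d q))
        (frechet_derivative (transition c d) (at (coord c q)) v))) (at (coord c q))"
  proof (rule has_derivative_transform_within_open[OF comp])
    show "open (coord c ` ?U)"
      using assms by (intro open_overlap[of c d] openin_Int openin_chart_dom) auto
    show "coord c q \<in> coord c ` ?U" using assms by simp
    show "transition d e (transition c d x) = transition c e x" if "x \<in> coord c ` ?U" for x
      using that assms(1-3) by (auto simp: transition_coord)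
  qed
  from frechet_derivative_at[OF this] show ?thesis by metis
qed

lemma transition_derivative_self:
  assumes "c \<in> A" "q \<in> chart_dom c"
  shows "frechet_derivative (transition c c) (at (coord c q)) v = v"
proof -
  have "(transition c c has_derivative (\<lambda>v. v)) (at (coord c q))"
  proof (rule has_derivative_transform_within_open[OF has_derivative_ident])
    show "open (coord c ` chart_dom c)"
      using assms by (intro open_overlap[of c c] openin_chart_dom) auto
    show "coord c q \<in> coord c ` chart_dom c" using assms by simp
    show "x = transition c c x" if "x \<in> coord c ` chart_dom c" for x
      using that assms(1) by (auto simp: transition_coord)
  qed
  from frechet_derivative_at[OF this] show ?thesis by metis
qed

text \<open>The constant field \<open>v\<close> of the chart \<open>c\<close>, damped by \<open>\<beta>\<close> and carried to the other charts by the
  derivatives of the transition maps.\<close>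

definition cutoff_field :: "('a, 'n) chart \<Rightarrow> (real ^ 'n \<Rightarrow> real) \<Rightarrow> real ^ 'n \<Rightarrow> ('a, 'n) field" where
  "cutoff_field c \<beta> v = (\<lambda>d q. if d \<in> A \<and> q \<in> chart_dom d \<and> q \<in> chart_dom c
     then \<beta> (coord c q) *\<^sub>R frechet_derivative (transition c d) (at (coord c q)) v else 0)"

text \<open>In a chart \<open>d\<close> the field is smooth on the overlap with \<open>c\<close>, being composed of smooth maps, and it
  is zero off the part of the manifold that \<open>c\<close> maps to \<open>K\<close>.  That part is compact, hence closed in
  the Hausdorff space, so the overlap and the complement of that part form an open cover of the
  domain of \<open>d\<close>.\<close>

lemma vector_field_cutoff_field:
  assumes c: "c \<in> A" and \<beta>: "smooth_on UNIV \<beta>" "\<And>x. x \<notin> K \<Longrightarrow> \<beta> x = 0"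
    and K: "compact K" "K \<subseteq> coord c ` chart_dom c"
  shows "vector_field A (cutoff_field c \<beta> v)"
  unfolding vector_field_def
proof (intro conjI ballI allI impI)
  fix d q assume "\<not> (d \<in> A \<and> q \<in> chart_dom d)"
  then show "cutoff_field c \<beta> v d q = 0" by (auto simp: cutoff_field_def)
next
  fix d assume d: "d \<in> A"
  let ?K = "{q \<in> chart_dom c. coord c q \<in> K}"
  let ?F = "cutoff_field c \<beta> v d \<circ> chart_inv d"
  have "closedin M ?K"
    using compactin_coord_preimage[OF atlas_chart[OF c] K] manifold
    by (intro compactin_imp_closedin) (simp_all add: smooth_manifold_def)
  then have off: "openin M (chart_dom d - ?K)"
    using openin_chart_dom[OF d] by (rule openin_diff[rotated])
  let ?S = "coord d ` (chart_dom d \<inter> chart_dom c)"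
  have openS: "open ?S"
    using c d by (intro open_overlap[of d c] openin_Int openin_chart_dom) auto
  have onS: "smooth_on ?S ?F"
  proof (rule smooth_on_cong[OF openS])
    let ?h = "\<lambda>y. \<beta> y *\<^sub>R frechet_derivative (transition c d) (at y) v"
    have "smooth_on (coord c ` (chart_dom c \<inter> chart_dom d)) (transition c d)"
      using manifold c d by (simp add: smooth_manifold_def)
    moreover have "open (coord c ` (chart_dom c \<inter> chart_dom d))"
      using c d by (intro open_overlap[of c d] openin_Int openin_chart_dom) auto
    ultimately have h: "smooth_on (coord c ` (chart_dom c \<inter> chart_dom d)) ?h"
      by (intro smooth_on_bilinear[OF _ bounded_bilinear_scaleR]
          smooth_on_subset[OF \<beta>(1) subset_UNIV] smooth_on_frechet_derivative)
    show "smooth_on ?S (\<lambda>x. ?h (transition d c x))"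
    proof (rule smooth_on_compose[OF openS _ _ h])
      show "transition d c ` ?S \<subseteq> coord c ` (chart_dom c \<inter> chart_dom d)"
        using d by (auto simp: transition_coord)
      show "smooth_on ?S (transition d c)"
        using manifold c d by (simp add: smooth_manifold_def)
    qed
    show "?h (transition d c x) = ?F x" if "x \<in> ?S" for x
      using that d coord_inv_into[OF atlas_chart[OF d]]
      by (auto simp: transition_coord cutoff_field_def)
  qed
  have open_off: "open (coord d ` (chart_dom d - ?K))"
    using off d by (intro open_overlap[of d d]) auto
  have off_K: "smooth_on (coord d ` (chart_dom d - ?K)) ?F"
  proof (rule smooth_on_cong[OF open_off smooth_on_const[of _ 0]])
    show "0 = ?F x" if "x \<in> coord d ` (chart_dom d - ?K)" for x
      using that coord_inv_into[OF atlas_chart[OF d]] by (auto simp: cutoff_field_def intro!: \<beta>(2))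
  qed
  show "smooth_on (coord d ` chart_dom d) ?F"
  proof (rule smooth_on_local)
    fix x assume "x \<in> coord d ` chart_dom d"
    then have "x \<in> ?S \<or> x \<in> coord d ` (chart_dom d - ?K)" by auto
    then show "\<exists>T. open T \<and> x \<in> T \<and> smooth_on T ?F"
      using openS onS open_off off_K by blast
  qed
next
  fix d e q assume *: "d \<in> A" "e \<in> A" "q \<in> chart_dom d \<inter> chart_dom e"
  then show "cutoff_field c \<beta> v e q =
      frechet_derivative (transition d e) (at (coord d q)) (cutoff_field c \<beta> v d q)"
    using c transition_derivative_cocycle[of c d e q] linear_0[OF transition_derivative_linear[of d e q]]
      linear_scale[OF transition_derivative_linear[of d e q]]
    by (simp add: cutoff_field_def)
qed

text \<open>Linearity in \<open>v\<close> holds between global fields and not only at \<open>p\<close>, because one bump function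
  serves all tangent vectors.  It lets linearity of a connection pass to values at \<open>p\<close>.\<close>

lemma linear_vector_field_extension:
  assumes c: "c \<in> A" and p: "p \<in> chart_dom c"
  obtains X :: "real ^ 'n \<Rightarrow> ('a, 'n) field" where
    "\<And>v. vector_field A (X v)" "\<And>v. X v c p = v"
    "\<And>u v. X (u + v) = field_add (X u) (X v)" "\<And>r v. X (r *\<^sub>R v) = field_scale (\<lambda>_. r) (X v)"
proof -
  have "open (coord c ` chart_dom c)"
    using c by (intro open_overlap[of c c] openin_chart_dom) auto
  then obtain r where r: "r > 0" "cball (coord c p) r \<subseteq> coord c ` chart_dom c"
    using p open_contains_cball_eq by blast
  obtain \<beta> :: "real ^ 'n \<Rightarrow> real" where \<beta>: "smooth_on UNIV \<beta>" "\<beta> (coord c p) = 1"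
    "\<And>x. x \<notin> cball (coord c p) r \<Longrightarrow> \<beta> x = 0"
    using smooth_bump_exists[OF r(1), of "coord c p"] by blast
  show thesis
  proof (rule that[of "cutoff_field c \<beta>"])
    show "vector_field A (cutoff_field c \<beta> v)" for v
      using vector_field_cutoff_field[OF c \<beta>(1) \<beta>(3) compact_cball r(2)] .
    show "cutoff_field c \<beta> v c p = v" for v
      using c p \<beta>(2) by (simp add: cutoff_field_def transition_derivative_self)
    show "cutoff_field c \<beta> (u + v) = field_add (cutoff_field c \<beta> u) (cutoff_field c \<beta> v)" for u v
      using linear_add[OF transition_derivative_linear[OF c]]
      by (auto simp: cutoff_field_def field_add_def fun_eq_iff scaleR_right_distrib)
    show "cutoff_field c \<beta> (s *\<^sub>R v) = field_scale (\<lambda>_. s) (cutoff_field c \<beta> v)" for s v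
      using linear_scale[OF transition_derivative_linear[OF c]]
      by (auto simp: cutoff_field_def field_scale_def fun_eq_iff)
  qed
qed

lemma vector_field_diff:
  assumes X: "vector_field A X" and Y: "vector_field A Y"
  shows "vector_field A (field_diff X Y)"
  unfolding vector_field_def
proof (intro conjI ballI allI impI)
  fix c p assume "\<not> (c \<in> A \<and> p \<in> chart_dom c)"
  then have "X c p = 0" "Y c p = 0"
    using X Y unfolding vector_field_def by blast+
  then show "field_diff X Y c p = 0" by (simp add: field_diff_def)
next
  fix c assume c: "c \<in> A"
  have o: "open (coord c ` chart_dom c)"
    using c by (intro open_overlap[of c c] openin_chart_dom) auto
  have "smooth_on (coord c ` chart_dom c) (\<lambda>x. X c (chart_inv c x) + (- 1) *\<^sub>R Y c (chart_inv c x))"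
    using X Y c unfolding vector_field_def o_def
    by (intro smooth_on_add o smooth_on_bilinear[OF o bounded_bilinear_scaleR] smooth_on_const) auto
  then show "smooth_on (coord c ` chart_dom c) (field_diff X Y c \<circ> chart_inv c)"
    by (simp add: field_diff_def o_def)
next
  fix c d p assume *: "c \<in> A" "d \<in> A" "p \<in> chart_dom c \<inter> chart_dom d"
  let ?T = "frechet_derivative (transition c d) (at (coord c p))"
  have "linear ?T"
    using * by (intro transition_derivative_linear) auto
  moreover have "X d p = ?T (X c p)" "Y d p = ?T (Y c p)"
    using X Y * unfolding vector_field_def by blast+
  ultimately show "field_diff X Y d p = ?T (field_diff X Y c p)"
    by (simp add: field_diff_def linear_diff)
qed

end

section \<open>Unit timelike Killing fields\<close>

context
  fixes M :: "'a topology" and A :: "('a, 'n::finite) chart set" and g :: "('a, 'n) metric_field"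
    and D :: "('a, 'n) connection" and E :: "('a, 'n) field"
  assumes manifold: "smooth_manifold M A" and lorentzian: "lorentzian_metric A g"
    and levi_civita: "levi_civita A g D"
    and killing: "killing_field A g E" and unitary: "timelike_unitary A g E"
begin

lemma vector_field_E: "vector_field A E"
  using killing unfolding killing_field_def by (rule conjunct1)

lemma vector_field_D: "vector_field A X \<Longrightarrow> vector_field A Y \<Longrightarrow> vector_field A (D X Y)"
  using levi_civita unfolding levi_civita_def affine_connection_def by blast

lemma lie_bracket_eq:
  "vector_field A X \<Longrightarrow> vector_field A Y \<Longrightarrow> lie_bracket A X Y = field_diff (D X Y) (D Y X)"
  using levi_civita unfolding levi_civita_def torsion_free_def by metis

lemma deriv_along_metric:
  assumes "c \<in> A" "p \<in> chart_dom c" "vector_field A X" "vector_field A Y" "vector_field A Z"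
  shows "deriv_along c X (\<lambda>q. g c q (Y c q) (Z c q)) p =
    g c p (D X Y c p) (Z c p) + g c p (Y c p) (D X Z c p)"
  using levi_civita assms unfolding levi_civita_def metric_compatible_def by blast

context
  fixes c p
  assumes c: "c \<in> A" and p: "p \<in> chart_dom c"
begin

lemma metric_form: "lorentzian_form (g c p)"
  using lorentzian c p by (simp add: lorentzian_metric_def)

lemma metric_bilinear: "bilinear (g c p)"
  using metric_form by (simp add: lorentzian_form_def)

lemma metric_sym: "g c p u v = g c p v u"
  using metric_form by (simp add: lorentzian_form_def)

lemma unit_E: "g c p (E c p) (E c p) = - 1"
  using unitary c p by (simp add: timelike_unitary_def)

text \<open>The Lie derivative of the metric along \<open>E\<close> vanishes, and so does the covariant one; their difference
  is expressed by \<open>\<nabla>\<^sub>E X - [E, X] = \<nabla>\<^sub>X E\<close>.\<close>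

lemma killing_skew:
  assumes X: "vector_field A X" and Y: "vector_field A Y"
  shows "g c p (D X E c p) (Y c p) = - g c p (X c p) (D Y E c p)"
proof -
  have "deriv_along c E (\<lambda>q. g c q (X c q) (Y c q)) p =
      g c p (lie_bracket A E X c p) (Y c p) + g c p (X c p) (lie_bracket A E Y c p)"
    using killing c p X Y unfolding killing_field_def by blast
  with deriv_along_metric[OF c p vector_field_E X Y] show ?thesis
    by (simp add: lie_bracket_eq X Y vector_field_E field_diff_def
        bilinear_lsub[OF metric_bilinear] bilinear_rsub[OF metric_bilinear])
qed

lemma D_E_orthogonal_E:
  assumes X: "vector_field A X"
  shows "g c p (D X E c p) (E c p) = 0"
proof -
  have "is_chart M c" using manifold c by (simp add: smooth_manifold_def)
  then have "deriv_along c X (\<lambda>q. g c q (E c q) (E c q)) p = 0"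
    by (rule deriv_along_const[OF _ p]) (use unitary c in \<open>auto simp: timelike_unitary_def\<close>)
  then show ?thesis
    using deriv_along_metric[OF c p X vector_field_E vector_field_E]
    by (simp add: metric_sym[of "E c p"])
qed

end

text \<open>For every \<open>v\<close>, skewness turns \<open>g(\<nabla>\<^sub>E E, v)\<close> into \<open>- g(E, \<nabla>\<^sub>v E)\<close>, which is zero since \<open>E\<close> has
  constant length.\<close>

lemma E_geodesic: "D E E = (\<lambda>c p. 0)"
proof (intro ext)
  fix c p
  show "D E E c p = 0"
  proof (cases "c \<in> A \<and> p \<in> chart_dom c")
    case True
    then have c: "c \<in> A" and p: "p \<in> chart_dom c" by auto
    obtain X where X: "\<And>v. vector_field A (X v)" "\<And>v. X v c p = v"
      using linear_vector_field_extension[OF manifold c p] by metis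
    have "g c p (D E E c p) v = 0" for v
      using killing_skew[OF c p vector_field_E X(1)[of v]] D_E_orthogonal_E[OF c p X(1)[of v]]
      by (simp add: X(2) metric_sym[OF c p, of "E c p"])
    then show ?thesis by (rule lorentzian_form_nondegenerate[OF metric_form[OF c p]])
  next
    case False
    then show ?thesis
      using vector_field_D[OF vector_field_E vector_field_E] unfolding vector_field_def by blast
  qed
qed

lemma D_zero_field:
  assumes X: "vector_field A X"
  shows "D X (\<lambda>c p. 0) = (\<lambda>c p. 0)"
proof -
  have Z: "vector_field A (\<lambda>c p. 0)"
    using vector_field_D[OF vector_field_E vector_field_E] by (simp add: E_geodesic)
  have "D X (field_add (\<lambda>c p. 0) (\<lambda>c p. 0)) = field_add (D X (\<lambda>c p. 0)) (D X (\<lambda>c p. 0))"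
    using levi_civita X Z unfolding levi_civita_def affine_connection_def by blast
  then show ?thesis by (simp add: field_add_def fun_eq_iff)
qed

text \<open>The term \<open>\<nabla>\<^sub>X \<nabla>\<^sub>E E\<close> vanishes.  Differentiating \<open>g(\<nabla>\<^sub>X E, X) = 0\<close> along \<open>E\<close> rewrites the second term
  as \<open>g(\<nabla>\<^sub>X E, \<nabla>\<^sub>E X)\<close>, and skewness applied to the field \<open>[X, E] = \<nabla>\<^sub>X E - \<nabla>\<^sub>E X\<close> gives
  \<open>g(\<nabla>\<^sub>X E - \<nabla>\<^sub>E X, \<nabla>\<^sub>X E)\<close> for the third; the mixed products cancel.\<close>

lemma curvature_killing:
  assumes c: "c \<in> A" and p: "p \<in> chart_dom c" and X: "vector_field A X"
  shows "g c p (curvature A D X E E c p) (X c p) = g c p (D X E c p) (D X E c p)"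
proof -
  note bil = metric_bilinear[OF c p] and sym = metric_sym[OF c p]
  have DXE: "vector_field A (D X E)" and DEX: "vector_field A (D E X)"
    using X vector_field_E by (auto intro: vector_field_D)
  have "is_chart M c" using manifold c by (simp add: smooth_manifold_def)
  moreover have "g c q (D X E c q) (X c q) = 0" if "q \<in> chart_dom c" for q
    using killing_skew[OF c that X X] metric_sym[OF c that, of "X c q"] by simp
  ultimately have "deriv_along c E (\<lambda>q. g c q (D X E c q) (X c q)) p = 0"
    by (intro deriv_along_const[OF _ p])
  then have "g c p (D E (D X E) c p) (X c p) = - g c p (D X E c p) (D E X c p)"
    using deriv_along_metric[OF c p vector_field_E DXE X] by simp
  moreover have "g c p (D (field_diff (D X E) (D E X)) E c p) (X c p) =
      - g c p (D X E c p - D E X c p) (D X E c p)"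
    using killing_skew[OF c p vector_field_diff[OF manifold DXE DEX] X]
    by (simp add: field_diff_def)
  ultimately show ?thesis
    using sym[of "D E X c p" "D X E c p"]
    by (simp add: curvature_def E_geodesic D_zero_field[OF X] lie_bracket_eq[OF X vector_field_E]
        field_diff_def bilinear_lsub[OF bil] bilinear_lneg[OF bil])
qed

lemma D_E_nonzero:
  assumes neg: "negative_timelike_curvature A g D"
    and c: "c \<in> A" and p: "p \<in> chart_dom c" and X: "vector_field A X"
    and orth: "g c p (X c p) (E c p) = 0" and nz: "X c p \<noteq> 0"
  shows "D X E c p \<noteq> 0"
proof
  assume "D X E c p = 0"
  then have "g c p (curvature A D X E E c p) (X c p) = 0"
    by (simp add: curvature_killing[OF c p X] bilinear_lzero[OF metric_bilinear[OF c p]])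
  then have "sectional_curvature A g D c p X E = 0"
    by (simp add: sectional_curvature_def)
  moreover have "timelike_plane (g c p) (span {X c p, E c p})"
    by (rule timelike_plane_span[OF metric_form[OF c p] unit_E[OF c p] orth nz])
  then have "sectional_curvature A g D c p X E < 0"
    using neg X vector_field_E c p unfolding negative_timelike_curvature_def by blast
  ultimately show False by simp
qed

end

section \<open>Parity of the dimension\<close>

theorem theorem4p2:
  fixes M :: "'a topology"
    and A :: "('a, 'n::finite) chart set"
    and g :: "('a, 'n) metric_field"
    and D :: "('a, 'n) connection"
  assumes "smooth_manifold M A"
    and "compact_space M"
    and "lorentzian_metric A g"
    and "levi_civita A g D"
    and "negative_timelike_curvature A g D"
    and "\<exists>E. killing_field A g E \<and> timelike_unitary A g E"
  shows "odd CARD('n)"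
proof -
  obtain E where E: "killing_field A g E" "timelike_unitary A g E"
    using assms(6) by blast
  note setting = assms(1,3,4) E
  obtain c p where c: "c \<in> A" and p: "p \<in> chart_dom c"
    using assms(1) unfolding smooth_manifold_def by blast
  obtain X where X: "\<And>v. vector_field A (X v)" "\<And>v. X v c p = v"
    "\<And>u v. X (u + v) = field_add (X u) (X v)" "\<And>r v. X (r *\<^sub>R v) = field_scale (\<lambda>_. r) (X v)"
    using linear_vector_field_extension[OF assms(1) c p] by blast
  note bil = metric_bilinear[OF setting c p] and sym = metric_sym[OF setting c p]
  have VE: "vector_field A E" by (rule vector_field_E[OF setting])
  have aff: "affine_connection A D" using assms(4) by (simp add: levi_civita_def)
  define L where "L v = D (X v) E c p" for v
  have "linear L"
  proof
    fix u v
    have "D (field_add (X u) (X v)) E = field_add (D (X u) E) (D (X v) E)"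
      using aff X(1) VE unfolding affine_connection_def by blast
    then show "L (u + v) = L u + L v" by (simp add: L_def X(3) field_add_def)
  next
    fix r v
    have "smooth_function A (\<lambda>_. r)"
      by (simp add: smooth_function_def o_def smooth_on_const)
    then have "D (field_scale (\<lambda>_. r) (X v)) E = field_scale (\<lambda>_. r) (D (X v) E)"
      using aff X(1) VE unfolding affine_connection_def by blast
    then show "L (r *\<^sub>R v) = r *\<^sub>R L v" by (simp add: L_def X(4) field_scale_def)
  qed
  show ?thesis
  proof (rule odd_card_if_skew_radical_line[of "\<lambda>v w. g c p (L v) w" "\<lambda>v. g c p v (E c p)" "E c p"])
    show "bilinear (\<lambda>v w. g c p (L v) w)"
      using bil \<open>linear L\<close> unfolding bilinear_def by (auto intro: linear_compose[unfolded o_def])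
    show skew: "g c p (L v) w = - g c p (L w) v" for v w
      using killing_skew[OF setting c p X(1) X(1), of v w] sym[of v "L w"]
      by (simp add: L_def X(2))
    show "linear (\<lambda>v. g c p v (E c p))" using bil by (simp add: bilinear_def)
    show "g c p (L (E c p)) w = 0" for w
      using skew[of "E c p" w] D_E_orthogonal_E[OF setting c p X(1), of w] by (simp add: L_def)
    show "g c p (E c p) (E c p) \<noteq> 0" using unit_E[OF setting c p] by simp
    show "v = 0" if "g c p v (E c p) = 0" "\<And>w. g c p (L w) v = 0" for v
    proof (rule ccontr)
      assume "v \<noteq> 0"
      have "g c p (L v) w = 0" for w using skew[of v w] that(2) by simp
      then have "L v = 0" by (rule lorentzian_form_nondegenerate[OF metric_form[OF setting c p]])
      then show False
        using D_E_nonzero[OF setting assms(5) c p X(1)[of v]] that(1) \<open>v \<noteq> 0\<close>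
        by (simp add: X(2) L_def)
    qed
  qed
qed

end
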